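(* The monomials $\tilde\mu_a\,e(r)\,\mu_b^*$, where $a,b\in\mathbb{N}$ with $(a,b)=1$ and $r\in\mathbb{Q}/\mathbb{Z}$, form a basis of $\mathcal{A}_{\mathbb{Z}}$ as a free abelian group.
   Context: $\mathbb{N}$ is the set of positive integers; $(m,n)$ denotes the gcd. $\mathbb{Z}[\mathbb{Q}/\mathbb{Z}]$ is the group ring with canonical basis $e(r)$, $r\in\mathbb{Q}/\mathbb{Z}$, and $e(a+b)=e(a)e(b)$. For $n\in\mathbb{N}$, $\sigma_n$ is the ring endomorphism of $\mathbb{Z}[\mathbb{Q}/\mathbb{Z}]$ with $\sigma_n(e(r))=e(nr)$, and $\tilde\rho_n$ is the additive map with $\tilde\rho_n(e(r))=\sum_{ns=r}e(s)$ (sum over the $s\in\mathbb{Q}/\mathbb{Z}$ with $ns=r$). $\mathcal{A}_{\mathbb{Z}}=\mathbb{Z}[\mathbb{Q}/\mathbb{Z}]\rtimes_{\tilde\rho}\mathbb{N}$ is the (unital, associative) ring generated by the group ring $\mathbb{Z}[\mathbb{Q}/\mathbb{Z}]$ and elements $\tilde\mu_n,\mu_n^*$ ($n\in\mathbb{N}$), subject to the relations (for all $x\in\mathbb{Z}[\mathbb{Q}/\mathbb{Z}]$ and all $n,m\in\mathbb{N}$): $\tilde\mu_n x\mu_n^*=\tilde\rho_n(x)$; $\mu_n^*x=\sigma_n(x)\mu_n^*$; $x\tilde\mu_n=\tilde\mu_n\sigma_n(x)$; $\tilde\mu_{nm}=\tilde\mu_n\tilde\mu_m$; $\mu_{nm}^*=\mu_n^*\mu_m^*$;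 $\mu_n^*\tilde\mu_n=n$; and $\tilde\mu_n\mu_m^*=\mu_m^*\tilde\mu_n$ whenever $(n,m)=1$. By convention $\tilde\mu_1=\mu_1^*=1$. *)

theory Defs
  imports Complex_Main "HOL-Library.Poly_Mapping"
begin

typedef pnat = "{n::nat. 0 < n}" morphisms nat_of Abs_pnat
  by (rule exI [of _ 1]) simp

setup_lifting type_definition_pnat

instantiation pnat :: comm_monoid_mult
begin

lift_definition one_pnat :: pnat is 1 by simp
lift_definition times_pnat :: "pnat \<Rightarrow> pnat \<Rightarrow> pnat" is "(*)" by simp

instance
  by standard (transfer; simp add: algebra_simps)+

end

lemma nat_of_pos [simp]: "0 < nat_of n"
  using nat_of [of n] by simp

quotient_type qz = rat / "\<lambda>x y. x - y \<in> \<int>"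
proof (rule equivpI)
  show "reflp (\<lambda>x y :: rat. x - y \<in> \<int>)"
    by (simp add: reflp_def)
  show "symp (\<lambda>x y :: rat. x - y \<in> \<int>)"
    by (rule sympI) (drule Ints_minus, simp)
  show "transp (\<lambda>x y :: rat. x - y \<in> \<int>)"
    by (rule transpI) (drule (1) Ints_add, simp)
qed

instantiation qz :: ab_group_add
begin

lift_definition zero_qz :: qz is 0 .

lift_definition plus_qz :: "qz \<Rightarrow> qz \<Rightarrow> qz" is "(+)"
  by (drule (1) Ints_add) (simp add: algebra_simps)

lift_definition uminus_qz :: "qz \<Rightarrow> qz" is uminus
  by (drule Ints_minus) (simp add: algebra_simps)

lift_definition minus_qz :: "qz \<Rightarrow> qz \<Rightarrow> qz" is "(-)"
  by (drule (1) Ints_diff) (simp add: algebra_simps)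

instance
  by standard (transfer; simp)+

end

lift_definition qz_mult :: "pnat \<Rightarrow> qz \<Rightarrow> qz" is "\<lambda>n r. of_nat (nat_of n) * r"
  by (drule Ints_mult [OF Ints_of_nat]) (simp add: right_diff_distrib)

text \<open>
  The fibres of multiplication by \<open>n\<close> on \<open>\<rat>/\<int>\<close> are finite, so that the sum
  over them below is a genuine one.
\<close>

lemma qz_fibre:
  "{s. qz_mult n s = abs_qz q} =
     (\<lambda>i. abs_qz ((q + of_nat i) / of_nat (nat_of n))) ` {..<nat_of n}" (is "?L = ?R")
proof
  define N where "N = nat_of n"
  have N: "N > 0" by (simp add: N_def)
  show "?L \<subseteq> ?R"
  proof
    fix s assume "s \<in> ?L"
    obtain t where s: "s = abs_qz t"
      using Quotient3_abs_rep [OF Quotient3_qz, of s] by (rule that [OF HOL.sym])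
    have "of_nat N * t - q \<in> \<int>"
      using \<open>s \<in> ?L\<close> by (simp add: s qz_mult.abs_eq qz.abs_eq_iff N_def)
    then obtain k :: int where k: "of_nat N * t - q = of_int k" by (auto elim: Ints_cases)
    define i where "i = nat (k mod int N)"
    have i: "i < N" "int i = k mod int N"
      using N by (auto simp: i_def nat_less_iff)
    have "k = int N * (k div int N) + int i"
      by (simp add: i(2))
    from arg_cong [OF this, of "of_int :: int \<Rightarrow> rat"]
    have "(of_int k :: rat) = of_nat N * of_int (k div int N) + of_nat i"
      by (simp only: of_int_add of_int_mult of_int_of_nat_eq)
    then have "t - (q + of_nat i) / of_nat N = of_int (k div int N)"
      using k N by (simp add: field_simps)
    then have "s = abs_qz ((q + of_nat i) / of_nat N)"
      unfolding s qz.abs_eq_iff by simp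
    then show "s \<in> ?R" using i(1) by (auto simp: N_def)
  qed
  show "?R \<subseteq> ?L"
  proof
    fix s assume "s \<in> ?R"
    then obtain i where s: "s = abs_qz ((q + of_nat i) / of_nat N)"
      by (auto simp: N_def)
    have "of_nat N * ((q + of_nat i) / of_nat N) - q = of_nat i"
      using N by simp
    then show "s \<in> ?L"
      by (simp add: s qz_mult.abs_eq qz.abs_eq_iff flip: N_def)
  qed
qed

lemma card_qz_fibre: "card {s. qz_mult n s = r} = nat_of n"
proof -
  obtain q where r: "r = abs_qz q"
    using Quotient3_abs_rep [OF Quotient3_qz, of r] by (rule that [OF HOL.sym])
  define N where "N = nat_of n"
  have N: "N > 0" by (simp add: N_def)
  have "inj_on (\<lambda>i. abs_qz ((q + of_nat i) / of_nat N)) {..<N}"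
  proof (rule inj_onI)
    fix i j assume ij: "i \<in> {..<N}" "j \<in> {..<N}"
      and "abs_qz ((q + of_nat i) / of_nat N) = abs_qz ((q + of_nat j) / of_nat N)"
    then have "(q + of_nat i) / of_nat N - (q + of_nat j) / of_nat N \<in> \<int>"
      by (simp add: qz.abs_eq_iff)
    then obtain k :: int where "(q + of_nat i) / of_nat N - (q + of_nat j) / of_nat N = of_int k"
      by (auto elim: Ints_cases)
    then have "(of_nat i - of_nat j) / of_nat N = (of_int k :: rat)"
      by (simp flip: diff_divide_distrib)
    then have "(of_nat i :: rat) - of_nat j = of_nat N * of_int k"
      using N by (simp add: divide_eq_eq mult.commute)
    then have "(of_int (int i - int j) :: rat) = of_int (int N * k)" by simp
    then have *: "int i - int j = int N * k" by (simp only: of_int_eq_iff)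
    have "\<bar>int i - int j\<bar> < int N" using ij by auto
    moreover have "int N dvd int i - int j" unfolding * by simp
    ultimately have "int i - int j = 0"
      using dvd_imp_le_int [of "int i - int j" "int N"] by linarith
    then show "i = j" by simp
  qed
  then show ?thesis
    by (simp add: r qz_fibre card_image flip: N_def)
qed

lemma finite_qz_fibre: "finite {s. qz_mult n s = r}"
  by (rule card_ge_0_finite) (simp add: card_qz_fibre)

text \<open>
  Finitely supported functions with the convolution product; \<open>frag_of r\<close> is the basis
  element \<open>e(r)\<close>, and \<open>frag_extend\<close> is the additive extension of a function on the basis.
\<close>

type_synonym group_ring = "qz \<Rightarrow>\<^sub>0 int"

definition \<sigma> :: "pnat \<Rightarrow> group_ring \<Rightarrow> group_ring"
  where "\<sigma> n = frag_extend (\<lambda>r. frag_of (qz_mult n r))"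

definition \<rho> :: "pnat \<Rightarrow> group_ring \<Rightarrow> group_ring"
  where "\<rho> n = frag_extend (\<lambda>r. \<Sum>s | qz_mult n s = r. frag_of s)"

lemma \<sigma>_frag_of: "\<sigma> n (frag_of r) = frag_of (qz_mult n r)"
  by (simp add: \<sigma>_def)

lemma \<rho>_frag_of: "\<rho> n (frag_of r) = (\<Sum>s | qz_mult n s = r. frag_of s)"
  by (simp add: \<rho>_def)

lemma frag_of_add: "frag_of (r + s) = frag_of r * (frag_of s :: group_ring)"
  by (simp add: mult_single)

text \<open>
  Every element of the group ring is a generator; the relations below make \<open>In\<close> a
  unital ring homomorphism.
\<close>

datatype gen = In group_ring | Mu pnat | Mu_star pnat

text \<open>
  The free monoid, written additively because the product on \<open>\<Rightarrow>\<^sub>0\<close> is the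
  convolution with respect to addition of the keys.
\<close>

datatype word = Word (letters: "gen list")

instantiation word :: monoid_add
begin

definition zero_word :: word where "0 = Word []"
definition plus_word :: "word \<Rightarrow> word \<Rightarrow> word" where "u + v = Word (letters u @ letters v)"

instance
  by standard (simp_all add: zero_word_def plus_word_def)

end

type_synonym free_ring = "word \<Rightarrow>\<^sub>0 int"

definition var :: "gen \<Rightarrow> free_ring"
  where "var g = frag_of (Word [g])"

text \<open>The smallest ring congruence on the free ring containing the defining relations.\<close>

inductive bc_cong :: "free_ring \<Rightarrow> free_ring \<Rightarrow> bool" (infix \<open>\<doteq>\<close> 50)
  where
    refl: "x \<doteq> x"
  | sym: "x \<doteq> y \<Longrightarrow> y \<doteq> x"
  | trans: "x \<doteq> y \<Longrightarrow> y \<doteq> z \<Longrightarrow> x \<doteq> z"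
  | add: "x \<doteq> x' \<Longrightarrow> y \<doteq> y' \<Longrightarrow> x + y \<doteq> x' + y'"
  | mult: "x \<doteq> x' \<Longrightarrow> y \<doteq> y' \<Longrightarrow> x * y \<doteq> x' * y'"
  | In_one: "var (In 1) \<doteq> 1"
  | In_add: "var (In (a + b)) \<doteq> var (In a) + var (In b)"
  | In_mult: "var (In (a * b)) \<doteq> var (In a) * var (In b)"
  | Mu_one: "var (Mu 1) \<doteq> 1"
  | Mu_star_one: "var (Mu_star 1) \<doteq> 1"
  | Mu_In_Mu_star: "var (Mu n) * var (In a) * var (Mu_star n) \<doteq> var (In (\<rho> n a))"
  | Mu_star_In: "var (Mu_star n) * var (In a) \<doteq> var (In (\<sigma> n a)) * var (Mu_star n)"
  | In_Mu: "var (In a) * var (Mu n) \<doteq> var (Mu n) * var (In (\<sigma> n a))"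
  | Mu_mult: "var (Mu (n * m)) \<doteq> var (Mu n) * var (Mu m)"
  | Mu_star_mult: "var (Mu_star (n * m)) \<doteq> var (Mu_star n) * var (Mu_star m)"
  | Mu_star_Mu: "var (Mu_star n) * var (Mu n) \<doteq> of_nat (nat_of n)"
  | Mu_Mu_star: "coprime (nat_of n) (nat_of m) \<Longrightarrow>
      var (Mu n) * var (Mu_star m) \<doteq> var (Mu_star m) * var (Mu n)"

text \<open>
  The class \<open>ring_1\<close> requires \<open>0 \<noteq> 1\<close>.  We see this by evaluating in a commutative ring:
  the group ring acts through the augmentation, \<open>Mu n\<close> as \<open>n\<close> and \<open>Mu_star n\<close> as 1.
\<close>

definition aug :: "group_ring \<Rightarrow> group_ring"
  where "aug = frag_extend (\<lambda>_. 1)"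

primrec gen_value :: "gen \<Rightarrow> group_ring"
  where
    "gen_value (In a) = aug a"
  | "gen_value (Mu n) = of_nat (nat_of n)"
  | "gen_value (Mu_star n) = 1"

definition free_value :: "free_ring \<Rightarrow> group_ring"
  where "free_value = frag_extend (\<lambda>w. prod_list (map gen_value (letters w)))"

lemma frag_extend_mult:
  fixes f :: "'a :: monoid_add \<Rightarrow> 'b :: monoid_add \<Rightarrow>\<^sub>0 int"
  assumes f: "\<And>u v. f (u + v) = f u * f v"
  shows "frag_extend f (x * y) = frag_extend f x * frag_extend f y"
proof -
  have 1: "frag_extend f (frag_of u * y) = f u * frag_extend f y" for u
    using subset_UNIV
  proof (induction y rule: frag_induction)
    case (one v)
    have "frag_of u * frag_of v = (frag_of (u + v) :: 'a \<Rightarrow>\<^sub>0 int)"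
      by (simp add: mult_single)
    then show ?case by (simp add: f)
  qed (simp_all add: frag_extend_diff right_diff_distrib)
  show ?thesis
    using subset_UNIV
    by (induction x rule: frag_induction) (simp_all add: 1 frag_extend_diff left_diff_distrib)
qed

lemma aug_one: "aug 1 = 1"
  unfolding aug_def single_one [symmetric] by (simp only: frag_extend_of)

lemma aug_add: "aug (x + y) = aug x + aug y"
  by (simp add: aug_def frag_extend_add)

lemma aug_mult: "aug (x * y) = aug x * aug y"
  unfolding aug_def by (rule frag_extend_mult) simp

lemma aug_\<sigma>: "aug (\<sigma> n x) = aug x"
  using subset_UNIV
  by (induction x rule: frag_induction) (simp_all add: aug_def \<sigma>_def frag_extend_diff)

lemma aug_\<rho>: "aug (\<rho> n x) = of_nat (nat_of n) * aug x"
  using subset_UNIV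
proof (induction x rule: frag_induction)
  case (one r)
  have "aug (\<rho> n (frag_of r)) = (\<Sum>s | qz_mult n s = r. aug (frag_of s))"
    unfolding \<rho>_frag_of by (simp add: aug_def frag_extend_sum finite_qz_fibre)
  then show ?case by (simp add: aug_def card_qz_fibre)
qed (simp_all add: aug_def \<rho>_def frag_extend_diff right_diff_distrib)

lemma free_value_mult: "free_value (x * y) = free_value x * free_value y"
  unfolding free_value_def by (rule frag_extend_mult) (simp add: plus_word_def)

lemma free_value_add: "free_value (x + y) = free_value x + free_value y"
  by (simp add: free_value_def frag_extend_add)

lemma free_value_one: "free_value 1 = 1"
  unfolding free_value_def single_one [symmetric] by (simp only: frag_extend_of) (simp add: zero_word_def)

lemma free_value_of_nat: "free_value (of_nat n) = of_nat n"
  by (induction n) (simp_all add: free_value_add free_value_one, simp add: free_value_def)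

lemma free_value_var: "free_value (var g) = gen_value g"
  by (simp add: free_value_def var_def)

lemma bc_cong_free_value: "x \<doteq> y \<Longrightarrow> free_value x = free_value y"
  by (induction rule: bc_cong.induct)
    (simp_all add: free_value_mult free_value_add free_value_one free_value_of_nat free_value_var
      aug_one aug_add aug_mult aug_\<sigma> aug_\<rho> one_pnat.rep_eq times_pnat.rep_eq mult.commute)

lemma bc_cong_uminus: "x \<doteq> y \<Longrightarrow> - x \<doteq> - y"
  using bc_cong.mult [OF bc_cong.refl [of "- 1"], of x y] by simp

quotient_type bc_ring = free_ring / bc_cong
  by (rule equivpI) (auto simp: reflp_def symp_def transp_def intro: bc_cong.intros)

instantiation bc_ring :: ring_1
begin

lift_definition zero_bc_ring :: bc_ring is 0 .
lift_definition one_bc_ring :: bc_ring is 1 .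
lift_definition plus_bc_ring :: "bc_ring \<Rightarrow> bc_ring \<Rightarrow> bc_ring" is "(+)" by (rule bc_cong.add)
lift_definition times_bc_ring :: "bc_ring \<Rightarrow> bc_ring \<Rightarrow> bc_ring" is "(*)" by (rule bc_cong.mult)
lift_definition uminus_bc_ring :: "bc_ring \<Rightarrow> bc_ring" is uminus by (rule bc_cong_uminus)
lift_definition minus_bc_ring :: "bc_ring \<Rightarrow> bc_ring \<Rightarrow> bc_ring" is "(-)"
  using bc_cong.add [OF _ bc_cong_uminus] by fastforce

instance
proof
  show "(0 :: bc_ring) \<noteq> 1"
  proof transfer
    show "\<not> (0 :: free_ring) \<doteq> 1"
    proof
      assume "(0 :: free_ring) \<doteq> 1"
      from bc_cong_free_value [OF this] show False
        by (simp add: free_value_one) (simp add: free_value_def)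
    qed
  qed
qed (transfer; simp add: algebra_simps bc_cong.refl)+

end

lift_definition emb :: "group_ring \<Rightarrow> bc_ring" is "\<lambda>a. var (In a)" .
lift_definition \<mu> :: "pnat \<Rightarrow> bc_ring" is "\<lambda>n. var (Mu n)" .
lift_definition \<mu>_star :: "pnat \<Rightarrow> bc_ring" is "\<lambda>n. var (Mu_star n)" .

abbreviation int_scale :: "int \<Rightarrow> 'a :: ring_1 \<Rightarrow> 'a"
  where "int_scale k x \<equiv> of_int k * x"

lemma module_int_scale: "module int_scale"
  by unfold_locales (simp_all add: algebra_simps)

definition int_basis :: "('i \<Rightarrow> 'a :: ring_1) \<Rightarrow> 'i set \<Rightarrow> bool"
  where "int_basis b I \<longleftrightarrow>
    inj_on b I \<and> \<not> module.dependent int_scale (b ` I) \<and> module.span int_scale (b ` I) = UNIV"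

end

theory Submission
  imports Defs
begin

text \<open>
  The relations move every product of generators into the form \<open>\<mu> a * x * \<mu>_star b\<close>, and a common
  factor \<open>d\<close> of \<open>a\<close> and \<open>b\<close> is absorbed into \<open>\<rho> d x\<close>; so the monomials span.  For
  independence, the ring acts on \<open>\<int>[\<rat>/\<int>]\<close> by multiplication, \<open>\<rho> n\<close> and \<open>\<sigma> n\<close>.  All
  relations are homogeneous when \<open>\<mu> n\<close> has degree \<open>n\<close> and \<open>\<mu>_star n\<close> has degree \<open>1 / n\<close>, so
  this lifts to a graded action on \<open>\<int>[\<rat>/\<int> \<times> \<rat>]\<close>.  There \<open>\<mu> a * e(r) * \<mu>_star b\<close> sends the
  unit vector in degree 1 to the sum of the \<open>e(t)\<close> with \<open>a t = r\<close>, placed in degree \<open>a / b\<close>.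
  The degree determines the coprime pair, and then any single \<open>t\<close> determines \<open>r\<close>: reading off
  one coefficient gives functionals dual to the monomials.
\<close>

section \<open>Arithmetic of positive integers and of \<open>\<rat>/\<int>\<close>\<close>

text \<open>Here \<open>d\<close> is the gcd. In a monomial it is absorbed by
  \<open>\<rho> d\<close>, and in a product \<open>\<mu>_star n * \<mu> a\<close> it becomes an
  integer factor.\<close>

lemma pnat_gcd_decompose:
  obtains d a' b' where "a = d * a'" "b = d * b'" "coprime (nat_of a') (nat_of b')"
proof
  define g where "g = gcd (nat_of a) (nat_of b)"
  have g: "0 < g" by (simp add: g_def)
  have pos: "0 < nat_of a div g" "0 < nat_of b div g"
    by (simp_all add: g_def div_greater_zero_iff gcd_le1_nat gcd_le2_nat)
  show "a = Abs_pnat g * Abs_pnat (nat_of a div g)" "b = Abs_pnat g * Abs_pnat (nat_of b div g)"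
    using g pos by (simp_all add: nat_of_inject [symmetric] times_pnat.rep_eq Abs_pnat_inverse g_def)
  show "coprime (nat_of (Abs_pnat (nat_of a div g))) (nat_of (Abs_pnat (nat_of b div g)))"
    using pos by (simp add: Abs_pnat_inverse) (simp add: g_def div_gcd_coprime)
qed

text \<open>Uniqueness of lowest terms: this is how the degree of a vector recovers the pair of
  indices of a monomial.\<close>

lemma pnat_coprime_fraction_eq:
  assumes "coprime (nat_of a) (nat_of b)" "coprime (nat_of c) (nat_of d)"
    and "(of_nat (nat_of a) / of_nat (nat_of b) :: rat) = of_nat (nat_of c) / of_nat (nat_of d)"
  shows "a = c" "b = d"
proof -
  have "(of_nat (nat_of a * nat_of d) :: rat) = of_nat (nat_of c * nat_of b)"
    using assms(3) by (simp add: frac_eq_eq)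
  then have "nat_of a * nat_of d = nat_of c * nat_of b"
    by (simp only: of_nat_eq_iff)
  with assms(1,2) have "nat_of a = nat_of c \<and> nat_of b = nat_of d"
    by (metis coprime_crossproduct_nat mult.commute)
  then show "a = c" "b = d" by (simp_all add: nat_of_inject)
qed

lemma qz_mult_add: "qz_mult n (r + s) = qz_mult n r + qz_mult n s"
  by transfer (simp add: algebra_simps)

lemma qz_mult_diff: "qz_mult n (r - s) = qz_mult n r - qz_mult n s"
  by transfer (simp add: algebra_simps)

lemma qz_mult_mult: "qz_mult (n * m) r = qz_mult n (qz_mult m r)"
  by transfer (simp add: times_pnat.rep_eq algebra_simps)

lemma qz_mult_one: "qz_mult 1 r = r"
  by transfer (simp add: one_pnat.rep_eq)

lemma qz_mult_commute: "qz_mult n (qz_mult m r) = qz_mult m (qz_mult n r)"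
  by (metis qz_mult_mult mult.commute)

lemma qz_coprime_torsion:
  assumes "coprime (nat_of n) (nat_of m)" "qz_mult n r = 0" "qz_mult m r = 0"
  shows "r = 0"
  using assms
proof transfer
  fix n m :: pnat and r :: rat
  assume co: "coprime (nat_of n) (nat_of m)"
    and *: "of_nat (nat_of n) * r - 0 \<in> \<int>" "of_nat (nat_of m) * r - 0 \<in> \<int>"
  \<comment> \<open>Bezout writes \<open>r\<close> as an integer combination of \<open>n r\<close>
    and \<open>m r\<close>, which are both integers.\<close>
  obtain x y where xy: "x * int (nat_of n) + y * int (nat_of m) = 1"
    using co bezout_int [of "int (nat_of n)" "int (nat_of m)"] by auto
  have "r = of_int (x * int (nat_of n) + y * int (nat_of m)) * r"
    unfolding xy by simp
  also have "\<dots> = of_int x * (of_nat (nat_of n) * r) + of_int y * (of_nat (nat_of m) * r)"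
    by (simp add: algebra_simps)
  finally show "r - 0 \<in> \<int>"
    using * by (metis Ints_add Ints_mult Ints_of_int diff_zero)
qed

text \<open>Translation by \<open>s\<close> is a bijection from the fibre over \<open>r\<close> to
  the fibre over \<open>r + n s\<close>.\<close>

lemma sum_qz_fibre_mult_add:
  "(\<Sum>t | qz_mult n t = r + qz_mult n s. f t) = (\<Sum>u | qz_mult n u = r. f (u + s))"
  by (rule sum.reindex_bij_witness [of _ "\<lambda>u. u + s" "\<lambda>t. t - s"])
    (auto simp: qz_mult_add qz_mult_diff)

text \<open>The fibre of \<open>n * m\<close> is partitioned by the value
  \<open>u = m t\<close>.\<close>

lemma sum_qz_fibre_times:
  "(\<Sum>t | qz_mult (n * m) t = s. f t) = (\<Sum>u | qz_mult n u = s. \<Sum>t | qz_mult m t = u. f t)"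
  by (subst sum.Sigma)
    (auto simp: finite_qz_fibre qz_mult_mult
      intro!: sum.reindex_bij_witness [of _ snd "\<lambda>t. (qz_mult m t, t)"])

text \<open>
  Multiplication by \<open>m\<close> is injective on the fibre by coprimality, and both fibres have
  \<open>n\<close> elements.
\<close>

lemma sum_qz_fibre_coprime:
  assumes "coprime (nat_of n) (nat_of m)"
  shows "(\<Sum>t | qz_mult n t = qz_mult m s. f t) = (\<Sum>u | qz_mult n u = s. f (qz_mult m u))"
proof -
  have inj: "inj_on (qz_mult m) {u. qz_mult n u = s}"
  proof (rule inj_onI)
    fix u v assume "u \<in> {u. qz_mult n u = s}" "v \<in> {u. qz_mult n u = s}"
      and "qz_mult m u = qz_mult m v"
    then have "qz_mult n (u - v) = 0" "qz_mult m (u - v) = 0"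
      by (simp_all add: qz_mult_diff)
    from qz_coprime_torsion [OF assms this] show "u = v" by simp
  qed
  have "qz_mult m ` {u. qz_mult n u = s} = {t. qz_mult n t = qz_mult m s}"
  proof (rule card_subset_eq)
    show "qz_mult m ` {u. qz_mult n u = s} \<subseteq> {t. qz_mult n t = qz_mult m s}"
      using qz_mult_commute by blast
  qed (simp_all only: finite_qz_fibre card_image [OF inj] card_qz_fibre)
  then show ?thesis
    using sum.reindex [OF inj, of f] by simp
qed

section \<open>The graded representation\<close>

text \<open>
  The second component of a basis element is its degree; it lies in \<open>\<rat>\<close> rather than in the
  positive rationals only to avoid a further type.
\<close>

type_synonym graded_module = "qz \<times> rat \<Rightarrow>\<^sub>0 int"

primrec gen_act :: "gen \<Rightarrow> graded_module \<Rightarrow> graded_module"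
  where
    "gen_act (In a) = frag_extend (\<lambda>(s, q). frag_extend (\<lambda>r. frag_of (r + s, q)) a)"
  | "gen_act (Mu n) = frag_extend (\<lambda>(s, q).
       \<Sum>t | qz_mult n t = s. frag_of (t, of_nat (nat_of n) * q))"
  | "gen_act (Mu_star n) = frag_extend (\<lambda>(s, q).
       frag_of (qz_mult n s, q / of_nat (nat_of n)))"

definition word_act :: "word \<Rightarrow> graded_module \<Rightarrow> graded_module"
  where "word_act w = foldr gen_act (letters w)"

definition free_act :: "free_ring \<Rightarrow> graded_module \<Rightarrow> graded_module"
  where "free_act x m = frag_extend (\<lambda>w. word_act w m) x"

section \<open>Additivity and multiplicativity of the action\<close>

lemma frag_sum_const:
  fixes m :: "'a \<Rightarrow>\<^sub>0 int"
  shows "(\<Sum>i\<in>A. m) = frag_cmul (int (card A)) m"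
  by (cases "finite A") (induction A rule: infinite_finite_induct, simp_all add: frag_cmul_distrib)

text \<open>Phrased with differences to match \<open>frag_induction\<close>, which builds all
  elements from basis elements by subtraction.\<close>

lemma frag_additive_eqI:
  fixes f g :: "('a \<Rightarrow>\<^sub>0 int) \<Rightarrow> 'b :: ab_group_add"
  assumes "f 0 = 0" "g 0 = 0"
    and "\<And>x y. f (x - y) = f x - f y" "\<And>x y. g (x - y) = g x - g y"
    and "\<And>a. f (frag_of a) = g (frag_of a)"
  shows "f x = g x"
  using subset_UNIV by (induction x rule: frag_induction) (simp_all add: assms)

lemma gen_act_zero: "gen_act g 0 = 0"
  by (cases g) simp_all

lemma gen_act_diff: "gen_act g (x - y) = gen_act g x - gen_act g y"
  by (cases g) (simp_all add: frag_extend_diff)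

lemma gen_act_sum: "gen_act g (sum f A) = (\<Sum>i\<in>A. gen_act g (f i))"
proof (induction A rule: infinite_finite_induct)
  case (insert i A)
  have "gen_act g (f i + sum f A) = gen_act g (f i) + gen_act g (sum f A)"
    by (cases g) (simp_all add: frag_extend_add)
  with insert show ?case by simp
qed (simp_all add: gen_act_zero)

lemma word_act_zero: "word_act w 0 = 0"
proof -
  have "foldr gen_act gs 0 = 0" for gs
    by (induction gs) (simp_all add: gen_act_zero)
  then show ?thesis by (simp add: word_act_def)
qed

lemma word_act_diff: "word_act w (x - y) = word_act w x - word_act w y"
proof -
  have "foldr gen_act gs (x - y) = foldr gen_act gs x - foldr gen_act gs y" for gs
    by (induction gs) (simp_all add: gen_act_diff)
  then show ?thesis by (simp add: word_act_def)
qed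

lemma word_act_add: "word_act (u + v) m = word_act u (word_act v m)"
  by (simp add: word_act_def plus_word_def)

lemma free_act_zero: "free_act 0 m = 0"
  by (simp add: free_act_def)

lemma free_act_add: "free_act (x + y) m = free_act x m + free_act y m"
  by (simp add: free_act_def frag_extend_add)

lemma free_act_diff: "free_act (x - y) m = free_act x m - free_act y m"
  by (simp add: free_act_def frag_extend_diff)

lemma free_act_frag_of: "free_act (frag_of w) m = word_act w m"
  by (simp add: free_act_def)

lemma free_act_var: "free_act (var g) m = gen_act g m"
  by (simp add: free_act_def var_def word_act_def)

lemma free_act_one: "free_act 1 m = m"
  unfolding free_act_def single_one [symmetric]
  by (simp only: frag_extend_of) (simp add: word_act_def zero_word_def)

lemma free_act_of_nat: "free_act (of_nat k) m = frag_cmul (int k) m"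
  by (induction k) (simp_all add: free_act_zero free_act_add free_act_one frag_cmul_distrib)

lemma free_act_zero_right: "free_act x 0 = 0"
  by (simp add: free_act_def word_act_zero frag_extend_eq_0)

lemma free_act_diff_right: "free_act x (m - n) = free_act x m - free_act x n"
  using subset_UNIV
  by (induction x rule: frag_induction)
    (simp_all add: free_act_zero free_act_frag_of free_act_diff word_act_diff)

text \<open>Both sides are additive in \<open>x\<close> and in \<open>y\<close>, which reduces the
  claim to words, where concatenation acts by composition.\<close>

lemma free_act_mult: "free_act (x * y) m = free_act x (free_act y m)"
proof -
  have *: "free_act (frag_of u * y) m = free_act (frag_of u) (free_act y m)" for u
    using subset_UNIV
  proof (induction y rule: frag_induction)
    case (one v)
    have "frag_of u * frag_of v = (frag_of (u + v) :: free_ring)"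
      by (simp add: mult_single)
    then show ?case by (simp add: free_act_frag_of word_act_add)
  qed (simp_all add: free_act_zero free_act_zero_right free_act_diff right_diff_distrib
      free_act_diff_right)
  show ?thesis
    using subset_UNIV
    by (induction x rule: frag_induction)
      (simp_all add: * free_act_zero free_act_diff left_diff_distrib)
qed

section \<open>The defining relations hold for the action\<close>

lemma gen_act_In_zero: "gen_act (In 0) m = 0"
  by (simp add: frag_extend_eq_0 split: prod.split)

lemma gen_act_In_add: "gen_act (In (a + b)) m = gen_act (In a) m + gen_act (In b) m"
  using subset_UNIV
  by (induction m rule: frag_induction) (auto simp: frag_extend_diff frag_extend_add)

lemma gen_act_In_diff: "gen_act (In (a - b)) m = gen_act (In a) m - gen_act (In b) m"
  using subset_UNIV
  by (induction m rule: frag_induction) (auto simp: frag_extend_diff)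

lemma gen_act_In_sum: "gen_act (In (sum f A)) m = (\<Sum>i\<in>A. gen_act (In (f i)) m)"
  by (induction A rule: infinite_finite_induct)
    (simp_all add: gen_act_In_zero gen_act_In_add del: gen_act.simps)

lemma gen_act_In_of: "gen_act (In (frag_of r)) (frag_of (s, q)) = frag_of (r + s, q)"
  by simp

lemma gen_act_Mu_of: "gen_act (Mu n) (frag_of (s, q)) =
    (\<Sum>t | qz_mult n t = s. frag_of (t, of_nat (nat_of n) * q))"
  by simp

lemma gen_act_Mu_star_of:
  "gen_act (Mu_star n) (frag_of (s, q)) = frag_of (qz_mult n s, q / of_nat (nat_of n))"
  by simp

lemmas gen_act_of = gen_act_In_of gen_act_Mu_of gen_act_Mu_star_of

text \<open>Basis vectors are given as explicit pairs so that the rules \<open>gen_act_of\<close>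
  apply to them directly.\<close>

lemma graded_operator_eqI:
  fixes f g :: "graded_module \<Rightarrow> graded_module"
  assumes "f 0 = 0" "g 0 = 0"
    and "\<And>x y. f (x - y) = f x - f y" "\<And>x y. g (x - y) = g x - g y"
    and "\<And>s q. f (frag_of (s, q)) = g (frag_of (s, q))"
  shows "f x = g x"
  by (rule frag_additive_eqI [of f g]) (use assms in auto)

lemmas gen_act_additive = gen_act_zero gen_act_diff gen_act_In_zero gen_act_In_diff

lemma gen_act_In_one: "gen_act (In 1) m = m"
  by (rule graded_operator_eqI [where f = "gen_act (In 1)"])
    (simp_all only: gen_act_additive single_one [symmetric] gen_act_In_of add_0_left)

lemma gen_act_In_mult: "gen_act (In (a * b)) m = gen_act (In a) (gen_act (In b) m)"
proof (rule graded_operator_eqI [where f = "gen_act (In (a * b))"])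
  fix s q
  \<comment> \<open>Additivity in \<open>b\<close>, and afterwards in \<open>a\<close>, leaves only
    basis elements, where the claim is associativity of addition in \<open>qz\<close>.\<close>
  have *: "gen_act (In (frag_of r * b)) (frag_of (s, q)) =
      gen_act (In (frag_of r)) (gen_act (In b) (frag_of (s, q)))" for r
    by (rule frag_additive_eqI [where x = b])
      (simp_all only: mult_zero_right right_diff_distrib gen_act_additive gen_act_of
        frag_of_add [symmetric] add.assoc)
  show "gen_act (In (a * b)) (frag_of (s, q)) = gen_act (In a) (gen_act (In b) (frag_of (s, q)))"
    by (rule frag_additive_eqI [where x = a])
      (simp_all only: mult_zero_left left_diff_distrib gen_act_additive *)
qed (simp_all only: gen_act_additive)

lemma gen_act_Mu_one: "gen_act (Mu 1) m = m"
  by (rule graded_operator_eqI [where f = "gen_act (Mu 1)"])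
    (simp_all only: gen_act_additive gen_act_of, simp add: qz_mult_one one_pnat.rep_eq)

lemma gen_act_Mu_star_one: "gen_act (Mu_star 1) m = m"
  by (rule graded_operator_eqI [where f = "gen_act (Mu_star 1)"])
    (simp_all only: gen_act_additive gen_act_of, simp add: qz_mult_one one_pnat.rep_eq)

lemma \<sigma>_additive: "\<sigma> n 0 = 0" "\<sigma> n (x - y) = \<sigma> n x - \<sigma> n y"
  by (simp_all add: \<sigma>_def frag_extend_diff)

lemma \<rho>_additive: "\<rho> n 0 = 0" "\<rho> n (x - y) = \<rho> n x - \<rho> n y"
  by (simp_all add: \<rho>_def frag_extend_diff)

text \<open>On basis elements the left side sums over the fibre above \<open>r + n s\<close>, a
  translate by \<open>s\<close> of the fibre above \<open>r\<close>; the two changes of degree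
  cancel.\<close>

lemma gen_act_Mu_In_Mu_star:
  "gen_act (Mu n) (gen_act (In a) (gen_act (Mu_star n) m)) = gen_act (In (\<rho> n a)) m"
proof (rule graded_operator_eqI [where g = "gen_act (In (\<rho> n a))"])
  fix s q
  show "gen_act (Mu n) (gen_act (In a) (gen_act (Mu_star n) (frag_of (s, q)))) =
      gen_act (In (\<rho> n a)) (frag_of (s, q))"
    by (rule frag_additive_eqI [where x = a])
      (simp_all only: gen_act_additive \<rho>_additive \<rho>_frag_of gen_act_In_sum gen_act_of
        sum_qz_fibre_mult_add, simp)
qed (simp_all only: gen_act_additive)

lemma gen_act_Mu_star_In:
  "gen_act (Mu_star n) (gen_act (In a) m) = gen_act (In (\<sigma> n a)) (gen_act (Mu_star n) m)"
proof (rule graded_operator_eqI [where g = "\<lambda>m. gen_act (In (\<sigma> n a)) (gen_act (Mu_star n) m)"])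
  fix s q
  show "gen_act (Mu_star n) (gen_act (In a) (frag_of (s, q))) =
      gen_act (In (\<sigma> n a)) (gen_act (Mu_star n) (frag_of (s, q)))"
    by (rule frag_additive_eqI [where x = a])
      (simp_all only: gen_act_additive \<sigma>_additive \<sigma>_frag_of gen_act_of qz_mult_add)
qed (simp_all only: gen_act_additive)

lemma gen_act_In_Mu:
  "gen_act (In a) (gen_act (Mu n) m) = gen_act (Mu n) (gen_act (In (\<sigma> n a)) m)"
proof (rule graded_operator_eqI [where g = "\<lambda>m. gen_act (Mu n) (gen_act (In (\<sigma> n a)) m)"])
  fix s q
  have *: "gen_act (In (frag_of r)) (gen_act (Mu n) (frag_of (s, q))) =
      gen_act (Mu n) (gen_act (In (\<sigma> n (frag_of r))) (frag_of (s, q)))" for r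
  proof -
    \<comment> \<open>The fibre above \<open>n r + s\<close> is the fibre above \<open>s\<close>
      translated by \<open>r\<close>.\<close>
    have "(\<Sum>t | qz_mult n t = qz_mult n r + s. frag_of (t, of_nat (nat_of n) * q) :: graded_module) =
        (\<Sum>t | qz_mult n t = s. frag_of (r + t, of_nat (nat_of n) * q))"
      using sum_qz_fibre_mult_add [where f = "\<lambda>t. frag_of (t, of_nat (nat_of n) * q) :: graded_module"
          and n = n and r = s and s = r]
      by (simp add: add.commute)
    then show ?thesis
      by (simp only: \<sigma>_frag_of gen_act_of gen_act_sum)
  qed
  show "gen_act (In a) (gen_act (Mu n) (frag_of (s, q))) =
      gen_act (Mu n) (gen_act (In (\<sigma> n a)) (frag_of (s, q)))"
    by (rule frag_additive_eqI [where x = a])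
      (simp_all only: gen_act_additive \<sigma>_additive *)
qed (simp_all only: gen_act_additive)

lemma gen_act_Mu_mult: "gen_act (Mu (n * m)) x = gen_act (Mu n) (gen_act (Mu m) x)"
proof (rule graded_operator_eqI [where f = "gen_act (Mu (n * m))"])
  fix s q
  \<comment> \<open>On the right \<open>Mu m\<close> acts first, so preimages under \<open>m\<close>
    are taken before those under \<open>n\<close>; splitting the fibre in this order requires the
    product \<open>m * n\<close>.\<close>
  show "gen_act (Mu (n * m)) (frag_of (s, q)) = gen_act (Mu n) (gen_act (Mu m) (frag_of (s, q)))"
    unfolding mult.commute [of n m]
    by (simp only: gen_act_of gen_act_sum sum_qz_fibre_times)
      (simp add: times_pnat.rep_eq mult_ac)
qed (simp_all only: gen_act_additive)

lemma gen_act_Mu_star_mult: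
  "gen_act (Mu_star (n * m)) x = gen_act (Mu_star n) (gen_act (Mu_star m) x)"
  by (rule graded_operator_eqI [where f = "gen_act (Mu_star (n * m))"])
    (simp_all only: gen_act_additive gen_act_of,
      simp add: qz_mult_mult times_pnat.rep_eq mult.commute qz_mult_commute [of m])

text \<open>Multiplication by \<open>n\<close> sends all \<open>n\<close> points of the fibre above
  \<open>s\<close> back to \<open>s\<close>, and the degree returns to its old value.\<close>

lemma gen_act_Mu_star_Mu:
  "gen_act (Mu_star n) (gen_act (Mu n) m) = frag_cmul (int (nat_of n)) m"
proof (rule graded_operator_eqI [where g = "frag_cmul (int (nat_of n))"])
  fix s q
  have "gen_act (Mu_star n) (gen_act (Mu n) (frag_of (s, q))) =
      (\<Sum>t | qz_mult n t = s. frag_of (s, q))"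
    by (simp only: gen_act_of gen_act_sum) (rule sum.cong, simp_all)
  then show "gen_act (Mu_star n) (gen_act (Mu n) (frag_of (s, q))) =
      frag_cmul (int (nat_of n)) (frag_of (s, q))"
    by (simp only: frag_sum_const card_qz_fibre)
next
  show "frag_cmul (int (nat_of n)) (x - y) =
      frag_cmul (int (nat_of n)) x - frag_cmul (int (nat_of n)) y" for x y :: graded_module
    by (rule poly_mapping_eqI) (simp add: lookup_minus right_diff_distrib)
qed (simp_all only: gen_act_additive frag_cmul_zero2)

text \<open>By coprimality, multiplication by \<open>m\<close> carries the \<open>n\<close>-fibre
  above \<open>s\<close> onto the one above \<open>m s\<close>; both sides have degree
  \<open>q * n / m\<close>.\<close>

lemma gen_act_Mu_Mu_star:
  assumes "coprime (nat_of n) (nat_of m)"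
  shows "gen_act (Mu n) (gen_act (Mu_star m) x) = gen_act (Mu_star m) (gen_act (Mu n) x)"
proof (rule graded_operator_eqI [where g = "\<lambda>x. gen_act (Mu_star m) (gen_act (Mu n) x)"])
  fix s q
  show "gen_act (Mu n) (gen_act (Mu_star m) (frag_of (s, q))) =
      gen_act (Mu_star m) (gen_act (Mu n) (frag_of (s, q)))"
    by (simp only: gen_act_of gen_act_sum sum_qz_fibre_coprime [OF assms]) simp
qed (simp_all only: gen_act_additive)

text \<open>Each generating relation has been checked above; closure under sums and products follows
  from additivity and multiplicativity of \<open>free_act\<close>. Hence the action descends to the
  quotient ring.\<close>

lemma bc_cong_free_act: "x \<doteq> y \<Longrightarrow> free_act x = free_act y"
  by (induction rule: bc_cong.induct)
    (simp_all only: fun_eq_iff free_act_add free_act_mult free_act_one free_act_of_nat free_act_var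
      gen_act_In_one gen_act_In_add gen_act_In_mult gen_act_Mu_one gen_act_Mu_star_one
      gen_act_Mu_In_Mu_star gen_act_Mu_star_In gen_act_In_Mu gen_act_Mu_mult gen_act_Mu_star_mult
      gen_act_Mu_star_Mu gen_act_Mu_Mu_star simp_thms)

lift_definition bc_act :: "bc_ring \<Rightarrow> graded_module \<Rightarrow> graded_module" is free_act
  by (rule bc_cong_free_act)

lemma bc_act_add: "bc_act (x + y) m = bc_act x m + bc_act y m"
  by transfer (rule free_act_add)

lemma bc_act_monomial:
  "bc_act (\<mu> a * emb (frag_of r) * \<mu>_star b) (frag_of (0, 1)) =
    (\<Sum>t | qz_mult a t = r. frag_of (t, of_nat (nat_of a) / of_nat (nat_of b)))"
proof -
  \<comment> \<open>So \<open>\<mu>_star b\<close> changes only the degree of the starting vector,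
    from 1 to \<open>1 / b\<close>.\<close>
  have "qz_mult b 0 = 0" by transfer simp
  moreover have "bc_act (\<mu> a * emb (frag_of r) * \<mu>_star b) m =
      gen_act (Mu a) (gen_act (In (frag_of r)) (gen_act (Mu_star b) m))" for m
    by transfer (simp only: free_act_mult free_act_var)
  ultimately show ?thesis
    by (simp only: gen_act_of) simp
qed

section \<open>Spanning\<close>

interpretation int_scale: module int_scale
  by (rule module_int_scale)

abbreviation monomial :: "pnat \<times> qz \<times> pnat \<Rightarrow> bc_ring"
  where "monomial \<equiv> \<lambda>(a, r, b). \<mu> a * emb (frag_of r) * \<mu>_star b"

abbreviation reduced :: "(pnat \<times> qz \<times> pnat) set"
  where "reduced \<equiv> {(a, r, b). coprime (nat_of a) (nat_of b)}"

abbreviation monomial_span :: "bc_ring set"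
  where "monomial_span \<equiv> module.span int_scale (monomial ` reduced)"

section \<open>The relations in the quotient ring\<close>

lemma of_nat_bc_ring_abs: "of_nat k = abs_bc_ring (of_nat k)"
  by (induction k)
    (simp_all add: zero_bc_ring_def one_bc_ring_def plus_bc_ring.abs_eq)

lemma \<mu>_one: "\<mu> 1 = 1"
  by transfer (rule bc_cong.Mu_one)

lemma \<mu>_star_one: "\<mu>_star 1 = 1"
  by transfer (rule bc_cong.Mu_star_one)

lemma emb_one: "emb 1 = 1"
  by transfer (rule bc_cong.In_one)

lemma emb_add: "emb (x + y) = emb x + emb y"
  by transfer (rule bc_cong.In_add)

lemma emb_mult: "emb (x * y) = emb x * emb y"
  by transfer (rule bc_cong.In_mult)

lemma \<mu>_emb_\<mu>_star: "\<mu> n * emb x * \<mu>_star n = emb (\<rho> n x)"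
  by transfer (rule bc_cong.Mu_In_Mu_star)

lemma \<mu>_star_emb: "\<mu>_star n * emb x = emb (\<sigma> n x) * \<mu>_star n"
  by transfer (rule bc_cong.Mu_star_In)

lemma emb_\<mu>: "emb x * \<mu> n = \<mu> n * emb (\<sigma> n x)"
  by transfer (rule bc_cong.In_Mu)

lemma \<mu>_mult: "\<mu> (n * m) = \<mu> n * \<mu> m"
  by transfer (rule bc_cong.Mu_mult)

lemma \<mu>_star_mult: "\<mu>_star (n * m) = \<mu>_star n * \<mu>_star m"
  by transfer (rule bc_cong.Mu_star_mult)

lemma \<mu>_star_\<mu>: "\<mu>_star n * \<mu> n = of_nat (nat_of n)"
  unfolding of_nat_bc_ring_abs \<mu>_def \<mu>_star_def
  by (simp add: times_bc_ring.abs_eq bc_ring.abs_eq_iff bc_cong.Mu_star_Mu)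

lemma \<mu>_\<mu>_star: "coprime (nat_of n) (nat_of m) \<Longrightarrow> \<mu> n * \<mu>_star m = \<mu>_star m * \<mu> n"
  by transfer (rule bc_cong.Mu_Mu_star)

lemma emb_diff: "emb (x - y) = emb x - emb y"
  using emb_add [of "x - y" y] by simp

lemma emb_zero: "emb 0 = 0"
  using emb_diff [of 0 0] by simp

section \<open>Reduction to coprime monomials\<close>

text \<open>The expression is additive in \<open>x\<close>. A general \<open>x\<close> is allowed
  because \<open>\<rho> d\<close> turns a single basis element into a sum of several.\<close>

lemma monomial_span_reduced:
  assumes "coprime (nat_of a) (nat_of b)"
  shows "\<mu> a * emb x * \<mu>_star b \<in> monomial_span"
  using subset_UNIV
proof (induction x rule: frag_induction)
  case (one r)
  from assms have "monomial (a, r, b) \<in> monomial ` reduced" by blast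
  then have "monomial (a, r, b) \<in> monomial_span" by (rule int_scale.span_base)
  then show ?case by simp
next
  case (diff x y)
  from int_scale.span_diff [OF this] show ?case
    by (simp only: emb_diff left_diff_distrib right_diff_distrib)
qed (simp add: emb_zero int_scale.span_zero)

lemma monomial_span_general: "\<mu> a * emb x * \<mu>_star b \<in> monomial_span"
proof -
  obtain d a' b' where *: "a = d * a'" "b = d * b'" "coprime (nat_of a') (nat_of b')"
    by (rule pnat_gcd_decompose)
  \<comment> \<open>Writing \<open>a\<close> as \<open>a' * d\<close> puts both factors indexed by
    \<open>d\<close> next to \<open>emb x\<close>.\<close>
  have "\<mu> a * emb x * \<mu>_star b = \<mu> a' * (\<mu> d * emb x * \<mu>_star d) * \<mu>_star b'"
    unfolding *(1,2) mult.commute [of d a'] by (simp only: \<mu>_mult \<mu>_star_mult mult.assoc)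
  also have "\<dots> = \<mu> a' * emb (\<rho> d x) * \<mu>_star b'"
    by (simp only: \<mu>_emb_\<mu>_star)
  finally show ?thesis
    using monomial_span_reduced [OF *(3)] by simp
qed

text \<open>Left multiplication by \<open>g\<close> is additive and commutes with the scalars, since
  integers are central.\<close>

lemma monomial_span_mult_left:
  assumes g: "\<And>a r b. g * (\<mu> a * emb (frag_of r) * \<mu>_star b) \<in> monomial_span"
    and x: "x \<in> monomial_span"
  shows "g * x \<in> monomial_span"
  using x
proof (induction x rule: int_scale.span_induct_alt)
  case base
  show ?case by (simp add: int_scale.span_zero)
next
  case (step c x y)
  then have "g * x \<in> monomial_span" using g by auto
  then have "of_int c * (g * x) + g * y \<in> monomial_span"
    using step by (intro int_scale.span_add int_scale.span_scale)
  moreover have "g * (of_int c * x + y) = of_int c * (g * x) + g * y"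
    by (simp only: distrib_left) (metis mult.assoc mult_of_int_commute)
  ultimately show ?case by simp
qed

lemma monomial_span_emb: "x \<in> monomial_span \<Longrightarrow> emb y * x \<in> monomial_span"
proof (rule monomial_span_mult_left)
  fix a r b
  have "emb y * (\<mu> a * emb (frag_of r) * \<mu>_star b) =
      (emb y * \<mu> a) * emb (frag_of r) * \<mu>_star b"
    by (simp only: mult.assoc)
  also have "\<dots> = \<mu> a * emb (\<sigma> a y * frag_of r) * \<mu>_star b"
    by (simp only: emb_mult emb_\<mu> mult.assoc)
  finally show "emb y * (\<mu> a * emb (frag_of r) * \<mu>_star b) \<in> monomial_span"
    using monomial_span_general by simp
qed

lemma monomial_span_\<mu>: "x \<in> monomial_span \<Longrightarrow> \<mu> n * x \<in> monomial_span"
proof (rule monomial_span_mult_left)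
  fix a r b
  have "\<mu> n * (\<mu> a * emb (frag_of r) * \<mu>_star b) = \<mu> (n * a) * emb (frag_of r) * \<mu>_star b"
    by (simp only: \<mu>_mult mult.assoc)
  then show "\<mu> n * (\<mu> a * emb (frag_of r) * \<mu>_star b) \<in> monomial_span"
    using monomial_span_general by simp
qed

text \<open>The gcd \<open>d\<close> of \<open>n\<close> and \<open>a\<close> leaves through
  \<open>\<mu>_star d * \<mu> d = d\<close>. The coprime cofactors commute, and then
  \<open>\<mu>_star n'\<close> passes \<open>emb\<close> by means of
  \<open>\<sigma> n'\<close>.\<close>

lemma monomial_span_\<mu>_star: "x \<in> monomial_span \<Longrightarrow> \<mu>_star n * x \<in> monomial_span"
proof (rule monomial_span_mult_left)
  fix a r b
  obtain d n' a' where *: "n = d * n'" "a = d * a'" "coprime (nat_of n') (nat_of a')"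
    by (rule pnat_gcd_decompose)
  have "\<mu>_star n * \<mu> a = \<mu>_star n' * (\<mu>_star d * \<mu> d) * \<mu> a'"
    unfolding * mult.commute [of d n'] by (simp only: \<mu>_mult \<mu>_star_mult mult.assoc)
  also have "\<dots> = of_nat (nat_of d) * (\<mu> a' * \<mu>_star n')"
    using *(3) unfolding \<mu>_star_\<mu>
    by (metis \<mu>_\<mu>_star coprime_commute mult.assoc mult_of_nat_commute)
  finally have "\<mu>_star n * (\<mu> a * emb (frag_of r) * \<mu>_star b) =
      of_nat (nat_of d) * (\<mu> a' * (\<mu>_star n' * emb (frag_of r)) * \<mu>_star b)"
    by (simp only: mult.assoc [symmetric])
  also have "\<dots> = of_int (int (nat_of d)) *
      (\<mu> a' * emb (\<sigma> n' (frag_of r)) * \<mu>_star (n' * b))"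
    by (simp only: \<mu>_star_emb \<mu>_star_mult mult.assoc of_int_of_nat_eq)
  finally show "\<mu>_star n * (\<mu> a * emb (frag_of r) * \<mu>_star b) \<in> monomial_span"
    by (simp only: int_scale.span_scale monomial_span_general)
qed

text \<open>The span contains 1 and is stable under left multiplication by every generator, hence
  contains all words.\<close>

lemma monomial_span_UNIV: "monomial_span = UNIV"
proof -
  have word: "abs_bc_ring (frag_of (Word gs)) \<in> monomial_span" for gs
  proof (induction gs)
    case Nil
    have "abs_bc_ring (frag_of (Word [])) = 1"
      by (simp add: one_bc_ring_def flip: zero_word_def)
    also have "\<dots> = \<mu> 1 * emb 1 * \<mu>_star 1"
      by (simp only: \<mu>_one \<mu>_star_one emb_one mult_1)
    finally show ?case
      using monomial_span_general by metis
  next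
    case (Cons g gs)
    have "frag_of (Word (g # gs)) = var g * frag_of (Word gs)"
      by (simp add: var_def mult_single plus_word_def)
    then have "abs_bc_ring (frag_of (Word (g # gs))) =
        abs_bc_ring (var g) * abs_bc_ring (frag_of (Word gs))"
      by (simp add: times_bc_ring.abs_eq)
    with Cons show ?case
      by (cases g)
        (simp_all add: monomial_span_emb monomial_span_\<mu> monomial_span_\<mu>_star
          flip: emb.abs_eq \<mu>.abs_eq \<mu>_star.abs_eq)
  qed
  have "abs_bc_ring x \<in> monomial_span" for x
    using subset_UNIV
  proof (induction x rule: frag_induction)
    case zero
    show ?case by (simp add: int_scale.span_zero flip: zero_bc_ring_def)
  next
    case (one w)
    show ?case using word [of "letters w"] by simp
  next
    case (diff x y)
    from int_scale.span_diff [OF this] show ?case by (simp only: minus_bc_ring.abs_eq)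
  qed
  then show ?thesis
    by (metis UNIV_eq_I Quotient3_abs_rep [OF Quotient3_bc_ring])
qed

section \<open>Linear independence\<close>

text \<open>Applying \<open>\<phi> i\<close> to a linear relation isolates its coefficient at
  \<open>b i\<close>. Additive functionals suffice because additive maps of abelian groups respect
  integer scalars.\<close>

lemma int_basisI_dual:
  fixes b :: "'i \<Rightarrow> 'a :: ring_1" and \<phi> :: "'i \<Rightarrow> 'a \<Rightarrow> int"
  assumes add: "\<And>i x y. \<phi> i (x + y) = \<phi> i x + \<phi> i y"
    and dual: "\<And>i j. i \<in> I \<Longrightarrow> j \<in> I \<Longrightarrow> \<phi> i (b j) = (if i = j then 1 else 0)"
    and span: "module.span int_scale (b ` I) = UNIV"
  shows "int_basis b I"
proof -
  \<comment> \<open>If \<open>b i = b j\<close> with \<open>i\<close> different from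
    \<open>j\<close>, then \<open>\<phi> i\<close> would take both values 1 and 0 there.\<close>
  have inj: "inj_on b I"
    by (rule inj_onI) (metis dual zero_neq_one)
  interpret \<phi>: Modules.additive "\<phi> i" for i
    by unfold_locales (rule add)
  have scale: "\<phi> i (of_int k * x) = k * \<phi> i x" for i k x
  proof -
    have nat: "\<phi> i (of_nat n * x) = int n * \<phi> i x" for n
      by (induction n) (simp_all add: \<phi>.zero add distrib_right)
    show ?thesis
      by (cases k rule: int_cases2) (simp_all add: nat \<phi>.minus)
  qed
  have independent: "u (b i) = 0" if "finite J" "J \<subseteq> I" "(\<Sum>v\<in>b ` J. of_int (u v) * v) = 0" "i \<in> J" for u i J
  proof -
    have "0 = \<phi> i (\<Sum>v\<in>b ` J. of_int (u v) * v)"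
      by (simp only: that \<phi>.zero)
    also have "\<dots> = (\<Sum>j\<in>J. u (b j) * \<phi> i (b j))"
      using inj_on_subset [OF inj \<open>J \<subseteq> I\<close>]
      by (simp add: \<phi>.sum scale sum.reindex)
    also have "\<dots> = (\<Sum>j\<in>J. if i = j then u (b j) else 0)"
      using that by (intro sum.cong) (auto simp: dual subset_iff)
    finally show ?thesis using that by simp
  qed
  have "\<not> int_scale.dependent (b ` I)"
    unfolding int_scale.independent_explicit_module
  proof (intro allI impI)
    fix t u v
    assume t: "finite t" "t \<subseteq> b ` I" "(\<Sum>v\<in>t. of_int (u v) * v) = 0" "v \<in> t"
    from finite_subset_image [OF t(1,2)] obtain J where J: "J \<subseteq> I" "finite J" "t = b ` J"
      by blast
    with t(4) obtain i where "i \<in> J" "v = b i" by blast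
    with J t(3) independent [of J u i] show "u v = 0" by simp
  qed
  with inj span show ?thesis by (simp add: int_basis_def)
qed

theorem corollary4p11:
  shows "int_basis (\<lambda>(a, r, b). \<mu> a * emb (frag_of r) * \<mu>_star b)
           {(a, r, b). coprime (nat_of a) (nat_of b)}"
proof -
  have "\<exists>t. qz_mult a t = r" for a r
  proof -
    have "{t. qz_mult a t = r} \<noteq> {}"
      using card_qz_fibre [of a r] nat_of_pos [of a] by force
    then show ?thesis by simp
  qed
  \<comment> \<open>An arbitrary point is chosen in each fibre; it determines \<open>r\<close> as
    its multiple by \<open>a\<close>.\<close>
  then obtain root where root: "\<And>a r. qz_mult a (root a r) = r"
    by metis
  \<comment> \<open>The coefficient at the chosen point in degree \<open>a / b\<close> after acting
    on the unit vector in degree 1.\<close>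
  define \<phi> where "\<phi> = (\<lambda>(a, r, b) x.
    Poly_Mapping.lookup (bc_act x (frag_of (0, 1))) (root a r, of_nat (nat_of a) / of_nat (nat_of b)))"
  have dual: "\<phi> i (monomial j) = (if i = j then 1 else 0)" if "i \<in> reduced" "j \<in> reduced" for i j
  proof -
    obtain a r b c s d where ij: "i = (a, r, b)" "j = (c, s, d)"
      by (metis prod_cases3)
    have "\<phi> i (monomial j) = (\<Sum>t | qz_mult c t = s. if root a r = t \<and>
        (of_nat (nat_of a) / of_nat (nat_of b) :: rat) = of_nat (nat_of c) / of_nat (nat_of d)
        then 1 else 0)"
      by (simp add: ij \<phi>_def bc_act_monomial lookup_sum)
    \<comment> \<open>Equal degrees force equal index pairs, both being coprime.\<close>
    also have "\<dots> = (\<Sum>t | qz_mult c t = s. if root a r = t \<and> a = c \<and> b = d then 1 else 0)"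
      using that by (intro sum.cong) (auto simp: ij dest: pnat_coprime_fraction_eq)
    \<comment> \<open>When \<open>a = c\<close>, the point \<open>root a r\<close> lies in the fibre
      above \<open>s\<close> exactly if \<open>r = s\<close>.\<close>
    also have "\<dots> = (if i = j then 1 else 0)"
      by (cases "a = c \<and> b = d") (auto simp: ij root finite_qz_fibre)
    finally show ?thesis .
  qed
  have add: "\<phi> i (x + y) = \<phi> i x + \<phi> i y" for i x y
    by (auto simp: \<phi>_def bc_act_add lookup_add split: prod.split)
  show ?thesis
    by (rule int_basisI_dual [of \<phi>, OF add dual monomial_span_UNIV])
qed

end
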